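(* Let $C, k\ge 1$ be integers, let $\gamma>0$ and $\eta>0$, and suppose that for all $c=1,\dots,C$, $f_c:\mathbb{R}^n\to\mathbb{R}$ is a differentiable function such that $I-\gamma\nabla f_c$ is $k$-conservative. Let $V_c = I-\gamma\nabla f_c$ and $V_s = \frac1C\sum_{c=1}^C (I - V_c^k)$. Then $V_s$ is a conservative vector field. In particular, there is some function $f_s:\mathbb{R}^n\to\mathbb{R}$ such that $V_s=\nabla f_s$ and the FedAvg server update $$x_{t+1} = x_t - \frac{\eta}{C}\sum_{c=1}^C\left(x_t - V_c^k(x_t)\right)$$ is equivalent to $$x_{t+1} = x_t - \eta\nabla f_s(x_t).$$
   Context: $I$ is the identity map on $\mathbb{R}^n$. For $V:\mathbb{R}^n\to\mathbb{R}^n$, $V^k$ denotes the $k$-fold composition $V\circ\cdots\circ V$. A vector field $V:\mathbb{R}^n\to\mathbb{R}^n$ is conservative if $V=\nabla g$ for some differentiable $g:\mathbb{R}^n\to\mathbb{R}$, and $k$-conservative if $V^k$ is conservative. In FedAvg, each of $C$ clients with loss $f_c$ performs $k$ steps of gradient descent with learning rate $\gamma$ on $f_c$ starting from the server model $x_t$ (producing $V_c^k(x_t)$), and the server updates its model by the displayed rule with server learning rate $\eta$. *)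

theory Defs
  imports "HOL-Analysis.Analysis"
begin

text \<open>The gradient as a total operator on top of the library relation \<open>GDERIV\<close>;
  the value at a point where the function is not differentiable is unspecified, so every use
  below is paired with a differentiability condition.\<close>

definition grad :: "('a::real_inner \<Rightarrow> real) \<Rightarrow> 'a \<Rightarrow> 'a" where
  "grad g x = (THE D. GDERIV g x :> D)"

definition conservative :: "('a::real_inner \<Rightarrow> 'a) \<Rightarrow> bool" where
  "conservative V \<longleftrightarrow> (\<exists>g. g differentiable_on UNIV \<and> V = grad g)"

definition k_conservative :: "nat \<Rightarrow> ('a::real_inner \<Rightarrow> 'a) \<Rightarrow> bool" where
  "k_conservative k V \<longleftrightarrow> conservative (V ^^ k)"

lemma grad_eqI:
  assumes "GDERIV g x :> D"
  shows "grad g x = D"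
  unfolding grad_def
proof (rule the_equality)
  show "GDERIV g x :> D"
    by (rule assms)
next
  fix D' assume "GDERIV g x :> D'"
  with assms have "(\<lambda>h. inner h D') = (\<lambda>h. inner h D)"
    unfolding gderiv_def by (metis has_derivative_unique)
  then have "inner h D' = inner h D" for h
    by metis
  then show "D' = D"
    by (metis vector_eq_rdot inner_commute)
qed

lemma GDERIV_grad:
  fixes g :: "'a::euclidean_space \<Rightarrow> real"
  assumes "g differentiable (at x)"
  shows "GDERIV g x :> grad g x"
proof -
  obtain g' where g': "(g has_derivative g') (at x)"
    using assms unfolding differentiable_def by blast
  define D where "D = (\<Sum>b\<in>Basis. g' b *\<^sub>R b)"
  have lin: "linear g'"
    using g' by (rule has_derivative_linear)
  have "g' h = inner h D" for h
  proof -
    have "g' h = g' (\<Sum>b\<in>Basis. inner h b *\<^sub>R b)"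
      by (simp add: euclidean_representation)
    also have "\<dots> = (\<Sum>b\<in>Basis. inner h b * g' b)"
      by (simp add: linear_sum[OF lin] linear_scale[OF lin])
    also have "\<dots> = inner h D"
      unfolding D_def by (simp add: inner_sum_right mult.commute)
    finally show ?thesis .
  qed
  then have "g' = (\<lambda>h. inner h D)"
    by blast
  with g' have "GDERIV g x :> D"
    by (simp add: gderiv_def)
  then show ?thesis
    by (simp add: grad_eqI)
qed

end

theory Submission
  imports Defs
begin

text \<open>
  Conservative fields form a linear space, because taking gradients is linear, and the identity
  field belongs to it, being the gradient of \<open>x \<mapsto> \<parallel>x\<parallel>\<^sup>2 / 2\<close>. The server field is a linear combination
  of the identity and of the fields \<open>V c ^^ k\<close>, which are conservative by hypothesis, so it is
  conservative as well. Any potential \<open>f\<^sub>s\<close> of it turns the averaged update into a gradient step: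
  the two right-hand sides are equal because \<open>\<eta> / C = \<eta> * (1 / C)\<close>.
\<close>

text \<open>A potential is more easily handled through the relation \<open>GDERIV\<close>, which has a calculus of
  its own and carries differentiability along, than through the operator \<open>grad\<close>.\<close>

lemma conservative_iff_GDERIV:
  fixes V :: "'a::euclidean_space \<Rightarrow> 'a"
  shows "conservative V \<longleftrightarrow> (\<exists>g. \<forall>x. GDERIV g x :> V x)"
proof
  assume "conservative V"
  then obtain g where "g differentiable_on UNIV" "V = grad g"
    unfolding conservative_def by blast
  then show "\<exists>g. \<forall>x. GDERIV g x :> V x"
    by (auto simp: differentiable_on_def intro!: GDERIV_grad)
next
  assume "\<exists>g. \<forall>x. GDERIV g x :> V x"
  then obtain g where g: "\<And>x. GDERIV g x :> V x"
    by blast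
  have "g differentiable_on UNIV"
    using g unfolding differentiable_on_def differentiable_def gderiv_def by blast
  moreover have "V = grad g"
    using grad_eqI[OF g] by (simp add: fun_eq_iff)
  ultimately show "conservative V"
    unfolding conservative_def by blast
qed

lemma conservative_id:
  "conservative (\<lambda>x::'a::euclidean_space. x)"
proof -
  have "GDERIV (\<lambda>x. inner x x / 2) x :> x" for x :: 'a
    unfolding gderiv_def
    by (auto intro!: derivative_eq_intros simp: inner_commute)
  then show ?thesis
    unfolding conservative_iff_GDERIV by blast
qed

lemma conservative_diff:
  fixes V W :: "'a::euclidean_space \<Rightarrow> 'a"
  assumes "conservative V" "conservative W"
  shows "conservative (\<lambda>x. V x - W x)"
  using assms unfolding conservative_iff_GDERIV by (meson GDERIV_diff)

lemma conservative_scaleR: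
  fixes V :: "'a::euclidean_space \<Rightarrow> 'a"
  assumes "conservative V"
  shows "conservative (\<lambda>x. r *\<^sub>R V x)"
proof -
  obtain g where "\<And>x. GDERIV g x :> V x"
    using assms unfolding conservative_iff_GDERIV by blast
  then have "GDERIV (\<lambda>x. r * g x) x :> r *\<^sub>R V x" for x
    unfolding gderiv_def by (auto intro!: derivative_eq_intros)
  then show ?thesis
    unfolding conservative_iff_GDERIV by blast
qed

lemma conservative_sum:
  fixes V :: "'i \<Rightarrow> 'a::euclidean_space \<Rightarrow> 'a"
  assumes "\<And>i. i \<in> A \<Longrightarrow> conservative (V i)"
  shows "conservative (\<lambda>x. \<Sum>i\<in>A. V i x)"
proof -
  obtain g where "\<And>i x. i \<in> A \<Longrightarrow> GDERIV (g i) x :> V i x"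
    using assms unfolding conservative_iff_GDERIV by metis
  then have "GDERIV (\<lambda>x. \<Sum>i\<in>A. g i x) x :> (\<Sum>i\<in>A. V i x)" for x
    unfolding gderiv_def inner_sum_right by (intro has_derivative_sum)
  then show ?thesis
    unfolding conservative_iff_GDERIV by blast
qed

theorem theorem11:
  fixes C k :: nat
    and \<gamma> \<eta> :: real
    and f :: "nat \<Rightarrow> real ^ 'n \<Rightarrow> real"
    and V :: "nat \<Rightarrow> real ^ 'n \<Rightarrow> real ^ 'n"
    and V\<^sub>s :: "real ^ 'n \<Rightarrow> real ^ 'n"
  assumes C: "C \<ge> 1" and k: "k \<ge> 1" and \<gamma>: "\<gamma> > 0" and \<eta>: "\<eta> > 0"
    and diff: "\<And>c. c \<in> {1..C} \<Longrightarrow> f c differentiable_on UNIV"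
    and V: "V = (\<lambda>c x. x - \<gamma> *\<^sub>R grad (f c) x)"
    and cons: "\<And>c. c \<in> {1..C} \<Longrightarrow> k_conservative k (V c)"
    and V\<^sub>s: "V\<^sub>s = (\<lambda>x. (1 / real C) *\<^sub>R (\<Sum>c=1..C. x - (V c ^^ k) x))"
  shows "conservative V\<^sub>s \<and>
    (\<exists>f\<^sub>s :: real ^ 'n \<Rightarrow> real. f\<^sub>s differentiable_on UNIV \<and> V\<^sub>s = grad f\<^sub>s \<and>
      (\<forall>(x :: nat \<Rightarrow> real ^ 'n) t.
        x (Suc t) = x t - (\<eta> / real C) *\<^sub>R (\<Sum>c=1..C. x t - (V c ^^ k) (x t)) \<longleftrightarrow>
        x (Suc t) = x t - \<eta> *\<^sub>R grad f\<^sub>s (x t)))"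
proof -
  have "conservative (\<lambda>x. x - (V c ^^ k) x)" if "c \<in> {1..C}" for c
    using cons[OF that] unfolding k_conservative_def
    by (intro conservative_diff conservative_id)
  then have conservative: "conservative V\<^sub>s"
    unfolding V\<^sub>s by (intro conservative_scaleR conservative_sum)
  then obtain f\<^sub>s where f\<^sub>s: "f\<^sub>s differentiable_on UNIV" "V\<^sub>s = grad f\<^sub>s"
    unfolding conservative_def by blast
  have "(\<eta> / real C) *\<^sub>R (\<Sum>c=1..C. y - (V c ^^ k) y) = \<eta> *\<^sub>R grad f\<^sub>s y" for y
    by (simp add: f\<^sub>s(2)[symmetric] V\<^sub>s)
  with conservative f\<^sub>s show ?thesis
    by auto
qed

end
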